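(* Let $\xi$ be a real random variable with distribution function $F$, tail $\overline F(x)=1-F(x)$, and $\xi^-=\max\{-\xi,0\}$. Let $m(x)=\mathbf E\min\{\xi^-,x\}$ for $x\ge0$, and let $$K:=\int_0^\infty\frac{x}{m(x)}\,F(dx).$$ Suppose $\mathbf E\xi^-=\infty$ and that either of the following conditions holds: (a) $F\in\mathcal S^*$; (b) $F\in\mathcal L\cap\mathcal D$ and $K<\infty$. Let $G_1$ be the distribution function on $[0,\infty)$ with tail $$\overline G_1(x)=\frac1K\int_x^\infty\frac{t-x}{m(t-x)}\,F(dt),\qquad x\ge0.$$ Then $G_1\in\mathcal S_F$.
   Context: Notation: $f(x)\sim g(x)$ means $f(x)/g(x)\to 1$ as $x\to\infty$. Class $\mathcal S^*$ (strong subexponential): $F\in\mathcal S^*$ if $\overline F(x)>0$ for all $x$, $\mu_+:=\int_0^\infty\overline F(y)\,dy<\infty$, and $\frac{1}{\overline F(x)}\int_0^x\overline F(x-y)\overline F(y)\,dy\to 2\mu_+$ as $x\to\infty$. Class $\mathcal L$ (long-tailed): $F\in\mathcal L$ if $\overline F(x)>0$ for all $x$ and, for every fixed $y>0$, $\overline F(x+y)/\overline F(x)\to1$ as $x\to\infty$. Class $\mathcal D$ (dominated varying tail): $F\in\mathcal D$ if $\sup_{x>0}\overline F(x/2)/\overline F(x)<\infty$. Class $\mathcal S_F$: a distribution function $G$ on $[0,\infty)$ belongs to $\mathcal S_F$ if $\int_0^x G(du)\,\overline F(x-u)\sim\overline F(x)$ as $x\to\infty$, the integral being over $[0,x]$.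 The integrals defining $K$ and $\overline G_1(x)$ are over $(0,\infty)$ and $(x,\infty)$ respectively; $m(x)>0$ for $x>0$. In case (a), $K<\infty$ holds automatically because $\mu_+<\infty$, so $G_1$ is well defined in both cases. *)

theory Defs
  imports "HOL-Probability.Probability" "HOL-Library.Landau_Symbols"
begin

definition distribution_functions :: "(real \<Rightarrow> real) set" where
  "distribution_functions = {F. mono F \<and> (\<forall>x. continuous (at_right x) F) \<and>
     (F \<longlongrightarrow> 0) at_bot \<and> (F \<longlongrightarrow> 1) at_top}"

definition tail :: "(real \<Rightarrow> real) \<Rightarrow> real \<Rightarrow> real" where
  "tail F x = 1 - F x"

definition strong_subexponential :: "(real \<Rightarrow> real) set" where
  "strong_subexponential = {F \<in> distribution_functions.
     (\<forall>x. tail F x > 0) \<and>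
     set_integrable lborel {0..} (tail F) \<and>
     ((\<lambda>x. 1 / tail F x * (LBINT y:{0..x}. tail F (x - y) * tail F y))
        \<longlongrightarrow> 2 * (LBINT y:{0..}. tail F y)) at_top}"

definition long_tailed :: "(real \<Rightarrow> real) set" where
  "long_tailed = {F \<in> distribution_functions.
     (\<forall>x. tail F x > 0) \<and>
     (\<forall>y>0. ((\<lambda>x. tail F (x + y) / tail F x) \<longlongrightarrow> 1) at_top)}"

text \<open>Positivity of the tail is implicit in the ratio; it is spelled out because
  division by zero yields zero here, which would admit distributions bounded above.\<close>

definition dominated_varying :: "(real \<Rightarrow> real) set" where
  "dominated_varying = {F \<in> distribution_functions.
     (\<forall>x. tail F x > 0) \<and>
     bdd_above ((\<lambda>x. tail F (x / 2) / tail F x) ` {0<..})}"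

text \<open>Integrals with respect to \<open>G(du)\<close> are taken against the Lebesgue--Stieltjes measure
  \<^term>\<open>interval_measure G\<close>. As \<open>G\<close> vanishes on the negative half-line, this measure has an
  atom of mass \<open>G 0\<close> at \<open>0\<close>, which the integral over \<open>[0, x]\<close> includes.\<close>

definition S_class :: "(real \<Rightarrow> real) \<Rightarrow> (real \<Rightarrow> real) set" where
  "S_class F = {G \<in> distribution_functions.
     (\<forall>x<0. G x = 0) \<and>
     (\<lambda>x. LINT u:{0..x}|interval_measure G. tail F (x - u)) \<sim>[at_top] tail F}"

definition truncated_neg_mean :: "'a measure \<Rightarrow> ('a \<Rightarrow> real) \<Rightarrow> real \<Rightarrow> real" where
  "truncated_neg_mean M X x = (\<integral>\<omega>. min (max (- X \<omega>) 0) x \<partial>M)"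

definition K_const :: "(real \<Rightarrow> real) \<Rightarrow> (real \<Rightarrow> real) \<Rightarrow> ennreal" where
  "K_const F m = (\<integral>\<^sup>+x\<in>{0<..}. ennreal (x / m x) \<partial>interval_measure F)"

definition G1 :: "(real \<Rightarrow> real) \<Rightarrow> (real \<Rightarrow> real) \<Rightarrow> real \<Rightarrow> real" where
  "G1 F m x = (if x < 0 then 0 else
     1 - enn2real ((\<integral>\<^sup>+t\<in>{x<..}. ennreal ((t - x) / m (t - x)) \<partial>interval_measure F)
                   / K_const F m))"

end

theory Submission imports Defs begin

text \<open>
Write \<open>T\<close> for the tail of \<open>F\<close>, \<open>r s = s / m s\<close>, and \<open>H x\<close> for the integral of \<open>r (t - x)\<close> over
\<open>t > x\<close> with respect to \<open>F\<close>, so that \<open>H / K\<close> is the tail of the distribution function \<open>G\<close> in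
question. The truncated mean \<open>m\<close> is concave, vanishes at \<open>0\<close>, and tends to infinity because \<open>\<xi>\<close> has
infinite negative mean. Therefore \<open>r\<close> is increasing and subadditive, and \<open>r (s + w) - r s\<close>, being at
most \<open>w / m s\<close>, tends to \<open>0\<close> for every \<open>w\<close>. Two estimates for the mass that \<open>G\<close> gives to an interval
follow:

  \<^item> it is at most \<open>r w * T (x - w) / K\<close> for \<open>(x - w, x]\<close> (\<open>excess_decrement_le\<close>);
  \<^item> for fixed \<open>w\<close> it is of smaller order than \<open>T x\<close> if \<open>F\<close> is long-tailed (\<open>excess_decrement_small\<close>).

The integral of \<open>T (x - u)\<close> over \<open>u\<close> in \<open>[0, A]\<close> with respect to \<open>G\<close> lies between \<open>G A * T x\<close> and
\<open>T (x - A)\<close>, and the latter is equivalent to \<open>T x\<close> as \<open>F\<close> is long-tailed. So \<open>G\<close> belongs to the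
class as soon as the integral over \<open>(A, x]\<close> is at most \<open>\<epsilon> * T x\<close> for suitable \<open>A\<close> and all large \<open>x\<close>
(\<open>S_classI\<close>). The two cases of the theorem reach this in different ways.

If \<open>F\<close> is strongly subexponential, it is long-tailed (\<open>strong_subexponential_long_tailed\<close>), and by the
second estimate \<open>G\<close> is, on unit intervals far to the right, dominated by a small multiple of \<open>T\<close>. The
integral is then at most a small multiple of the convolution of \<open>T\<close> with itself, which is of the order
of \<open>T x\<close> (\<open>far_mass_small_strong_subexponential\<close>).

If \<open>F\<close> is long-tailed with dominated variation, that convolution may be too large. Instead the integral
is read as the probability that independent variables with distributions \<open>G\<close> and \<open>F\<close> have a sum
exceeding \<open>x\<close> while the first lies in \<open>(A, x]\<close>, and is split according to the value \<open>w\<close> of the second.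
For moderate \<open>w\<close> the first estimate applies, with \<open>T (x - w)\<close> comparable to \<open>T x\<close>, and the integral of
\<open>r w\<close> over large \<open>w\<close> is small because \<open>K\<close> is finite (\<open>far_mass_small_dominated\<close>).
\<close>

section \<open>Tails of distribution functions\<close>

lemma distribution_functionsD:
  assumes "F \<in> distribution_functions"
  shows "real_distribution (interval_measure F)" and "cdf (interval_measure F) = F"
  using assms
  by (auto simp: distribution_functions_def mono_def
      intro!: real_distribution_interval_measure cdf_interval_measure)

lemma (in real_distribution) tail_cdf: "tail (cdf M) x = measure M {x<..}"
proof -
  have "measure M {x<..} = measure M (space M - {..x})" by (rule arg_cong[where f="measure M"]) auto
  also have "\<dots> = 1 - measure M {..x}" by (rule prob_compl) simp
  finally show ?thesis by (simp add: tail_def cdf_def)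
qed

lemma (in real_distribution) emeasure_tail: "emeasure M {x<..} = ennreal (tail (cdf M) x)"
  by (simp add: tail_cdf emeasure_eq_measure)

lemma (in real_distribution) tail_cdf_bounds: "0 \<le> tail (cdf M) x" "tail (cdf M) x \<le> 1"
  by (auto simp: tail_cdf)

lemma (in real_distribution) tail_cdf_antimono: "x \<le> y \<Longrightarrow> tail (cdf M) y \<le> tail (cdf M) x"
  by (simp add: tail_def cdf_nondecreasing)

lemma (in real_distribution) tail_cdf_measurable [measurable]: "tail (cdf M) \<in> borel_measurable borel"
proof -
  have "mono (cdf M)" by (auto intro: monoI cdf_nondecreasing)
  then have [measurable]: "cdf M \<in> borel_measurable borel" by (rule borel_measurable_mono)
  have "tail (cdf M) = (\<lambda>x. 1 - cdf M x)" by (auto simp: tail_def)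
  also have "\<dots> \<in> borel_measurable borel" by measurable
  finally show ?thesis .
qed

lemma tail_properties:
  assumes "F \<in> distribution_functions"
  shows tail_bounds: "0 \<le> tail F x" "tail F x \<le> 1"
    and tail_antimono: "x \<le> y \<Longrightarrow> tail F y \<le> tail F x"
    and tail_measurable: "tail F \<in> borel_measurable borel"
    and tail_tendsto_0: "(tail F \<longlongrightarrow> 0) at_top"
proof -
  interpret real_distribution "interval_measure F" by (rule distribution_functionsD[OF assms])
  note eq = distribution_functionsD(2)[OF assms]
  show "0 \<le> tail F x" "tail F x \<le> 1" "x \<le> y \<Longrightarrow> tail F y \<le> tail F x" "tail F \<in> borel_measurable borel"
    using tail_cdf_bounds tail_cdf_antimono tail_cdf_measurable unfolding eq by auto
  have "((\<lambda>x. 1 - F x) \<longlongrightarrow> 1 - 1) at_top"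
    using assms by (intro tendsto_intros) (auto simp: distribution_functions_def)
  then show "(tail F \<longlongrightarrow> 0) at_top" by (simp add: tail_def[abs_def])
qed

text \<open>
Negative shifts follow from positive ones: substitute \<open>x + y\<close> for \<open>x\<close> and invert the quotient.
\<close>

lemma long_tailed_shift:
  assumes F: "F \<in> long_tailed"
  shows "((\<lambda>x. tail F (x + y) / tail F x) \<longlongrightarrow> 1) at_top"
proof -
  have pos: "tail F x > 0" for x using F by (simp add: long_tailed_def)
  consider "y > 0" | "y = 0" | "y < 0" by linarith
  then show ?thesis
  proof cases
    case 1 then show ?thesis using F by (simp add: long_tailed_def)
  next
    case 2 then show ?thesis using pos by (simp add: less_imp_neq[symmetric])
  next
    case 3
    have "((\<lambda>x. tail F (x + - y) / tail F x) \<longlongrightarrow> 1) at_top" 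
      using F 3 by (simp add: long_tailed_def del: add_uminus_conv_diff)
    moreover have "filterlim (\<lambda>x. x + y) at_top at_top"
      using filterlim_tendsto_add_at_top[OF tendsto_const[of y] filterlim_ident] by (simp add: add.commute)
    ultimately have "((\<lambda>x. tail F (x + y + - y) / tail F (x + y)) \<longlongrightarrow> 1) at_top"
      by (rule filterlim_compose)
    then have "((\<lambda>x. inverse (tail F x / tail F (x + y))) \<longlongrightarrow> inverse 1) at_top"
      by (intro tendsto_inverse) auto
    then show ?thesis by simp
  qed
qed

text \<open>
For long-tailed \<open>F\<close> only the mass of \<open>G\<close> far to the right can spoil membership in \<open>S_class F\<close>. The
integral over \<open>[0, x]\<close> is at least \<open>G x * tail F x\<close>, and its part over \<open>[0, A]\<close> is at most
\<open>tail F (x - A)\<close>, which is equivalent to \<open>tail F x\<close>; the premise disposes of the part over \<open>(A, x]\<close>.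
That part is written as a nonnegative integral because it is going to be estimated by Tonelli.
\<close>

lemma S_classI:
  assumes F: "F \<in> long_tailed" and G: "G \<in> distribution_functions" "\<And>x. x < 0 \<Longrightarrow> G x = 0"
    and rest: "\<And>\<epsilon>. \<epsilon> > 0 \<Longrightarrow> \<exists>A. \<forall>\<^sub>F x in at_top.
      (\<integral>\<^sup>+u. ennreal (tail F (x - u)) * indicator {A<..x} u \<partial>interval_measure G) \<le> ennreal (\<epsilon> * tail F x)"
  shows "G \<in> S_class F"
proof -
  have Fd: "F \<in> distribution_functions" and pos: "tail F x > 0" for x 
    using F by (auto simp: long_tailed_def)
  note [measurable] = tail_measurable[OF Fd]
  note tb = tail_bounds[OF Fd]
  let ?\<nu> = "interval_measure G"
  interpret G: real_distribution ?\<nu> by (rule distribution_functionsD[OF G(1)])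
  have cdfG: "cdf ?\<nu> = G" by (rule distribution_functionsD[OF G(1)])
  define I where "I x = (LINT u:{0..x}|?\<nu>. tail F (x - u))" for x
  have int: "integrable ?\<nu> (\<lambda>u. indicator {0..x} u * tail F (x - u))" for x
    using tb by (intro G.integrable_const_bound[where B=1]) (auto simp: indicator_def)
  have I_eq: "I x = (\<integral>u. indicator {0..x} u * tail F (x - u) \<partial>?\<nu>)" for x
    unfolding I_def set_lebesgue_integral_def by simp
  have I_nn: "ennreal (I x) = (\<integral>\<^sup>+u. ennreal (indicator {0..x} u * tail F (x - u)) \<partial>?\<nu>)" for x
    unfolding I_eq using int tb by (intro nn_integral_eq_integral[symmetric]) auto
  have lower: "G x \<le> I x / tail F x" if "x \<ge> 0" for x
  proof -
    have "AE u in ?\<nu>. 0 \<le> u"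
    proof (rule AE_I)
      have "(G \<longlongrightarrow> G.prob {..<0}) (at_left 0)" using G.cdf_at_left[of 0] unfolding cdfG .
      moreover have "(G \<longlongrightarrow> 0) (at_left 0)"
        by (rule tendsto_eventually) (auto simp: eventually_at_left_field intro!: exI[of _ "-1"] G(2))
      ultimately have "G.prob {..<0} = 0" using tendsto_unique trivial_limit_at_left_real by blast
      then show "emeasure ?\<nu> {..<0} = 0" 
        by (simp add: G.emeasure_eq_measure)
    qed auto
    then have "AE u in ?\<nu>. indicator {..x} u * tail F x \<le> indicator {0..x} u * tail F (x - u)"
      by (rule AE_mp) (auto intro!: tail_antimono[OF Fd] simp: indicator_def)
    then have "(\<integral>u. indicator {..x} u * tail F x \<partial>?\<nu>) \<le> I x"
      unfolding I_eq by (intro integral_mono_AE int) (auto intro!: G.integrable_const_bound[where B=1] simp: tb indicator_def)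
    moreover have "(\<integral>u. indicator {..x} u * tail F x \<partial>?\<nu>) = G x * tail F x"
      using cdf_def2[of ?\<nu> x] cdfG by simp
    ultimately show ?thesis using pos[of x] by (simp add: pos_le_divide_eq)
  qed
  have "((\<lambda>x. I x / tail F x) \<longlongrightarrow> 1) at_top"
  proof (rule order_tendstoI)
    fix a :: real assume "a < 1"
    moreover have "(G \<longlongrightarrow> 1) at_top" using G(1) by (simp add: distribution_functions_def)
    ultimately have "\<forall>\<^sub>F x in at_top. a < G x" by (simp add: order_tendsto_iff)
    with eventually_ge_at_top[of 0] show "\<forall>\<^sub>F x in at_top. a < I x / tail F x"
      by eventually_elim (use lower in fastforce)
  next
    fix a :: real assume "1 < a"
    \<comment> \<open>The two error terms add up to \<open>2 * e\<close>, which must stay below \<open>a - 1\<close>.\<close>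
    define e where "e = (a - 1) / 3"
    have e: "e > 0" using \<open>1 < a\<close> by (simp add: e_def)
    obtain A where A: "\<forall>\<^sub>F x in at_top.
      (\<integral>\<^sup>+u. ennreal (tail F (x - u)) * indicator {A<..x} u \<partial>?\<nu>) \<le> ennreal (e * tail F x)"
      using rest[OF e] by blast
    have "\<forall>\<^sub>F x in at_top. tail F (x + - A) / tail F x < 1 + e"
      using order_tendstoD(2)[OF long_tailed_shift[OF F, of "-A"], of "1 + e"] e by simp
    with A show "\<forall>\<^sub>F x in at_top. I x / tail F x < a"
    proof eventually_elim
      case (elim x)
      have "ennreal (I x) \<le> (\<integral>\<^sup>+u. ennreal (tail F (x - A)) + 
              ennreal (tail F (x - u)) * indicator {A<..x} u \<partial>?\<nu>)"
        unfolding I_nn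
      proof (rule nn_integral_mono)
        fix u
        show "ennreal (indicator {0..x} u * tail F (x - u)) \<le> 
          ennreal (tail F (x - A)) + ennreal (tail F (x - u)) * indicator {A<..x} u"
          using tail_antimono[OF Fd, of "x - A" "x - u"] tb
          by (cases "u \<le> A") (auto simp: indicator_def intro!: ennreal_leI)
      qed
      also have "\<dots> = ennreal (tail F (x - A)) + 
              (\<integral>\<^sup>+u. ennreal (tail F (x - u)) * indicator {A<..x} u \<partial>?\<nu>)"
        using G.emeasure_space_1 by (subst nn_integral_add) auto
      also have "\<dots> \<le> ennreal (tail F (x - A)) + ennreal (e * tail F x)"
        by (intro add_left_mono elim)
      also have "\<dots> = ennreal (tail F (x - A) + e * tail F x)"
        using tb e by (intro ennreal_plus[symmetric]) auto
      finally have "I x \<le> tail F (x - A) + e * tail F x"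
        using tb e by (subst (asm) ennreal_le_iff) auto
      also have "\<dots> < (1 + e) * tail F x + e * tail F x"
        using elim pos[of x] by (simp add: pos_divide_less_eq)
      also have "\<dots> = (1 + 2 * e) * tail F x" by (simp add: algebra_simps)
      also have "\<dots> \<le> a * tail F x" using \<open>1 < a\<close> pos[of x] by (intro mult_right_mono) (auto simp: e_def field_simps)
      finally show ?case using pos[of x] by (simp add: pos_divide_less_eq)
    qed
  qed
  then have "I \<sim>[at_top] tail F" by (rule asymp_equivI')
  then show ?thesis unfolding S_class_def using G by (auto simp: I_def[abs_def])
qed

section \<open>The distribution with integrated weighted tail\<close>

text \<open>
The only properties of \<open>r s = s / m s\<close> that matter are collected here: it grows subadditively and so
slowly that its increments over steps of a fixed length vanish at infinity. The convention
\<open>r s = 0\<close> for \<open>s \<le> 0\<close> lets integrals over \<open>(x, \<infinity>)\<close> be written over the whole line. Continuity is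
demanded on the open half-line only, since \<open>s / m s\<close> jumps at \<open>0\<close>: its right limit there is
\<open>1 / P (\<xi> < 0)\<close>.
\<close>

locale weighted_tail = \<mu>: real_distribution \<mu> for \<mu> :: "real measure" +
  fixes r :: "real \<Rightarrow> real"
  assumes tail_pos: "0 < tail (cdf \<mu>) x"
    and r_nonpos: "s \<le> 0 \<Longrightarrow> r s = 0"
    and r_pos: "0 < s \<Longrightarrow> 0 < r s"
    and r_mono: "mono r"
    and r_cont: "continuous_on {0<..} r"
    and r_subadd: "0 < s \<Longrightarrow> 0 < w \<Longrightarrow> r (s + w) \<le> r s + r w"
    and r_slow: "0 < w \<Longrightarrow> ((\<lambda>s. r (s + w) - r s) \<longlongrightarrow> 0) at_top"
    and r_int: "integrable \<mu> r"
begin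

abbreviation T :: "real \<Rightarrow> real" where "T \<equiv> tail (cdf \<mu>)"

definition excess :: "real \<Rightarrow> real" where "excess x = (\<integral>t. r (t - x) \<partial>\<mu>)"

definition K :: real where "K = excess 0"

definition excess_cdf :: "real \<Rightarrow> real" where
  "excess_cdf x = (if x < 0 then 0 else 1 - excess x / K)"

lemma r_nonneg: "0 \<le> r s"
  using r_nonpos[of s] r_pos[of s] by (cases "s \<le> 0") auto

lemma r_measurable [measurable]: "r \<in> borel_measurable borel"
  using r_mono by (rule borel_measurable_mono)

lemma r_increment_le: "0 \<le> w \<Longrightarrow> r (s + w) - r s \<le> r w * indicator {- w<..} s"
proof -
  assume w: "0 \<le> w"
  consider "s \<le> - w" | "- w < s" "s \<le> 0" | "0 < s" "w = 0" | "0 < s" "0 < w" using w by linarith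
  then show ?thesis
  proof cases
    case 2
    then show ?thesis using r_nonpos[of s] monoD[OF r_mono, of "s + w" w] by simp
  qed (use w r_nonpos[of s] r_nonpos[of "s + w"] r_subadd[of s w] r_nonneg[of w] in auto)
qed

text \<open>
Subadditivity gives \<open>r (t - x) \<le> r t + r \<bar>x\<bar>\<close>, so \<open>excess\<close> is finite for negative arguments too;
below, decrements of \<open>excess\<close> are used without regard to the sign of the arguments.
\<close>

lemma integrable_r_shift: "integrable \<mu> (\<lambda>t. r (t - x))"
proof (rule Bochner_Integration.integrable_bound)
  show "integrable \<mu> (\<lambda>t. r t + r \<bar>x\<bar>)" using r_int by auto
  show "AE t in \<mu>. norm (r (t - x)) \<le> norm (r t + r \<bar>x\<bar>)"
  proof (rule AE_I2)
    fix t
    have "r (t - x) \<le> r (t + \<bar>x\<bar>)" by (rule monoD[OF r_mono]) auto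
    also have "\<dots> \<le> r t + r \<bar>x\<bar>"
      using r_increment_le[of "\<bar>x\<bar>" t] r_nonneg[of "\<bar>x\<bar>"] by (cases "- \<bar>x\<bar> < t") auto
    finally show "norm (r (t - x)) \<le> norm (r t + r \<bar>x\<bar>)" using r_nonneg by simp
  qed
qed auto

lemma excess_nonneg: "0 \<le> excess x"
  unfolding excess_def by (rule Bochner_Integration.integral_nonneg) (simp add: r_nonneg)

lemma excess_antimono: "x \<le> y \<Longrightarrow> excess y \<le> excess x"
  unfolding excess_def by (intro integral_mono integrable_r_shift monoD[OF r_mono]) auto

lemma excess_decrement:
  "excess (x - w) - excess x = (\<integral>t. r ((t - x) + w) - r (t - x) \<partial>\<mu>)"
  using integrable_r_shift[of "x - w"] integrable_r_shift[of x]
  by (simp add: excess_def algebra_simps)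

lemma integrable_r_increment: "integrable \<mu> (\<lambda>t. r ((t - x) + w) - r (t - x))"
  using integrable_r_shift[of "x - w"] integrable_r_shift[of x] by (simp add: algebra_simps)

lemma integrable_indicator: "A \<in> sets borel \<Longrightarrow> integrable \<mu> (indicator A :: real \<Rightarrow> real)"
  by (rule \<mu>.integrable_const_bound[where B=1]) auto

text \<open>
The first of two estimates on which everything rests. Passing from \<open>x\<close> to \<open>x - w\<close> increases the
integrand \<open>r (t - x)\<close> by at most \<open>r w\<close>, by subadditivity, and only where \<open>t > x - w\<close>.
\<close>

lemma excess_decrement_le:
  assumes "0 \<le> w" shows "excess (x - w) - excess x \<le> r w * T (x - w)"
proof -
  have "excess (x - w) - excess x \<le> (\<integral>t. r w * indicator {x - w<..} t \<partial>\<mu>)"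
    unfolding excess_decrement
  proof (rule integral_mono)
    fix t show "r ((t - x) + w) - r (t - x) \<le> r w * indicator {x - w<..} t"
      using r_increment_le[OF assms, of "t - x"] by (auto simp: indicator_def split: if_splits)
  qed (auto simp: integrable_indicator integrable_r_increment)
  also have "\<dots> = r w * T (x - w)" by (simp add: \<mu>.tail_cdf)
  finally show ?thesis .
qed

text \<open>
The second estimate. The increment of the integrand is at most \<open>r w\<close> where \<open>x - w < t \<le> x + S\<close>, a
window whose mass is negligible against \<open>T x\<close> because the tail is long; beyond \<open>x + S\<close> it is small
because the increments of \<open>r\<close> vanish at infinity.
\<close>

lemma excess_decrement_small:
  assumes L: "cdf \<mu> \<in> long_tailed" and w: "0 < w" and e: "0 < \<epsilon>"
  shows "\<forall>\<^sub>F x in at_top. excess (x - w) - excess x \<le> \<epsilon> * T x"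
proof -
  obtain S where S: "\<And>s. S \<le> s \<Longrightarrow> r (s + w) - r s \<le> \<epsilon> / 2" "0 \<le> S"
  proof -
    have "\<forall>\<^sub>F s in at_top. r (s + w) - r s < \<epsilon> / 2"
      using order_tendstoD(2)[OF r_slow[OF w], of "\<epsilon> / 2"] e by simp
    then obtain S where "\<And>s. S \<le> s \<Longrightarrow> r (s + w) - r s < \<epsilon> / 2"
      by (auto simp: eventually_at_top_linorder)
    then show ?thesis by (intro that[of "max S 0"]) (auto intro: less_imp_le)
  qed
  have bound: "excess (x - w) - excess x \<le> r w * (T (x + - w) - T (x + S)) + \<epsilon> / 2 * T (x + S)" for x
  proof -
    have "excess (x - w) - excess x \<le>
        (\<integral>t. r w * (indicator {x - w<..} t - indicator {x + S<..} t) + \<epsilon> / 2 * indicator {x + S<..} t \<partial>\<mu>)"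
      unfolding excess_decrement
    proof (rule integral_mono)
      fix t show "r ((t - x) + w) - r (t - x) \<le>
          r w * (indicator {x - w<..} t - indicator {x + S<..} t) + \<epsilon> / 2 * indicator {x + S<..} t"
        using r_increment_le[of w "t - x"] S(1)[of "t - x"] w S(2)
        by (auto simp: indicator_def split: if_splits)
    qed (auto simp: integrable_indicator integrable_r_increment)
    also have "\<dots> = r w * (T (x - w) - T (x + S)) + \<epsilon> / 2 * T (x + S)"
      by (simp add: \<mu>.tail_cdf integrable_indicator)
    finally show ?thesis by simp
  qed
  have "((\<lambda>x. r w * (T (x + - w) / T x - T (x + S) / T x) + \<epsilon> / 2 * (T (x + S) / T x)) \<longlongrightarrow>
      r w * (1 - 1) + \<epsilon> / 2 * 1) at_top"
    by (intro tendsto_intros long_tailed_shift[OF L])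
  then have "\<forall>\<^sub>F x in at_top. r w * (T (x + - w) / T x - T (x + S) / T x) + \<epsilon> / 2 * (T (x + S) / T x) < \<epsilon>"
    by (rule order_tendstoD(2)) (use e in simp)
  then show ?thesis
  proof eventually_elim
    case (elim x)
    have "excess (x - w) - excess x \<le> 
      (r w * (T (x + - w) / T x - T (x + S) / T x) + \<epsilon> / 2 * (T (x + S) / T x)) * T x"
    proof -
      have "(r w * (T (x + - w) / T x - T (x + S) / T x) + \<epsilon> / 2 * (T (x + S) / T x)) * T x =
          r w * (T (x + - w) - T (x + S)) + \<epsilon> / 2 * T (x + S)"
        using tail_pos[of x] by (simp add: field_simps)
      then show ?thesis using bound[of x] by simp
    qed
    also have "\<dots> \<le> \<epsilon> * T x" using elim tail_pos[of x] by (intro mult_right_mono) auto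
    finally show ?case .
  qed
qed

lemma K_eq: "K = (\<integral>t. r t \<partial>\<mu>)" by (simp add: K_def excess_def)

lemma K_pos: "0 < K"
proof -
  have "K \<noteq> 0"
  proof
    assume "K = 0"
    then have "AE t in \<mu>. r t = 0"
      using integral_nonneg_eq_0_iff_AE[OF r_int] by (simp add: r_nonneg K_eq)
    then have "AE t in \<mu>. t \<notin> {0<..}"
      by (rule AE_mp) (auto intro!: AE_I2 dest: r_pos)
    then have "\<mu>.prob {0<..} = 0"
      by (subst (asm) \<mu>.prob_eq_0[symmetric]) auto
    then show False using tail_pos[of 0] by (simp add: \<mu>.tail_cdf)
  qed
  moreover have "0 \<le> K" unfolding K_def by (rule excess_nonneg)
  ultimately show ?thesis by simp
qed

text \<open>
Dominated convergence; for \<open>t \<le> a\<close> both \<open>r (t - a)\<close> and \<open>r (t - y)\<close> with \<open>y > a\<close> vanish, so that the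
jump of \<open>r\<close> at \<open>0\<close> does no harm. Approaching \<open>a\<close> from the left, it could.
\<close>

lemma excess_tendsto_at_right: "(excess \<longlongrightarrow> excess a) (at_right a)"
proof (rule tendsto_at_right_sequentially[where b="a + 1"])
  fix S :: "nat \<Rightarrow> real" assume S: "\<And>n. a < S n" "S \<longlonglongrightarrow> a"
  show "(\<lambda>n. excess (S n)) \<longlonglongrightarrow> excess a"
    unfolding excess_def
  proof (rule integral_dominated_convergence[where w="\<lambda>t. r (t - a)"])
    show "AE t in \<mu>. (\<lambda>n. r (t - S n)) \<longlonglongrightarrow> r (t - a)"
    proof (rule AE_I2)
      fix t
      show "(\<lambda>n. r (t - S n)) \<longlonglongrightarrow> r (t - a)"
      proof (cases "t \<le> a")
        case True
        then have "r (t - S n) = r (t - a)" for n using S(1)[of n] by (simp add: r_nonpos)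
        then show ?thesis by simp
      next
        case False
        then have "isCont r (t - a)" 
          using r_cont by (simp add: continuous_on_eq_continuous_at)
        moreover have "(\<lambda>n. t - S n) \<longlonglongrightarrow> t - a" by (intro tendsto_intros S)
        ultimately show ?thesis by (rule isCont_tendsto_compose)
      qed
    qed
    show "AE t in \<mu>. norm (r (t - S n)) \<le> r (t - a)" for n
      using S(1)[of n] by (auto intro!: AE_I2 monoD[OF r_mono] simp: r_nonneg)
  qed (auto intro: integrable_r_shift)
qed auto

lemma excess_tendsto_0: "(excess \<longlongrightarrow> 0) at_top"
proof -
  have "((\<lambda>x. \<integral>t. r (t - x) \<partial>\<mu>) \<longlongrightarrow> (\<integral>t. 0 \<partial>\<mu>)) at_top"
  proof (rule integral_dominated_convergence_at_top[where w=r])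
    show "AE t in \<mu>. ((\<lambda>x. r (t - x)) \<longlongrightarrow> 0) at_top"
    proof (rule AE_I2)
      fix t show "((\<lambda>x. r (t - x)) \<longlongrightarrow> 0) at_top"
        by (rule tendsto_eventually) (use eventually_ge_at_top[of t] in eventually_elim, simp add: r_nonpos)
    qed
    show "\<forall>\<^sub>F x in at_top. AE t in \<mu>. norm (r (t - x)) \<le> r t"
      using eventually_ge_at_top[of 0]
      by eventually_elim (auto intro!: AE_I2 monoD[OF r_mono] simp: r_nonneg)
  qed (auto intro: r_int)
  then show ?thesis by (simp add: excess_def[abs_def])
qed

text \<open>
Equality holds for \<open>y \<ge> 0\<close>. For negative \<open>y\<close>, where \<open>excess_cdf\<close> is cut off, the right-hand side can
only be larger.
\<close>

lemma excess_cdf_increment: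
  assumes "y \<le> x"
  shows "excess_cdf x - excess_cdf y \<le> (excess y - excess x) / K"
  using K_pos excess_antimono[OF assms] assms excess_antimono[of y 0]
  by (auto simp: excess_cdf_def K_def diff_divide_distrib[symmetric] field_simps)

lemma mono_excess_cdf: "mono excess_cdf"
proof (rule monoI)
  fix x y :: real assume "x \<le> y"
  then show "excess_cdf x \<le> excess_cdf y"
    using K_pos excess_antimono[of x y] excess_antimono[of 0 y]
    by (auto simp: excess_cdf_def divide_right_mono K_def)
qed

lemma excess_cdf_distribution: "excess_cdf \<in> distribution_functions"
  unfolding distribution_functions_def
proof (intro CollectI conjI allI mono_excess_cdf)
  fix x :: real
  show "continuous (at_right x) excess_cdf"
  proof (cases "x < 0")
    case True
    have "(excess_cdf \<longlongrightarrow> 0) (at_right x)"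
      by (rule tendsto_eventually)
        (use True in \<open>auto simp: eventually_at_right_field excess_cdf_def intro!: exI[of _ 0]\<close>)
    then show ?thesis using True by (simp add: continuous_within excess_cdf_def)
  next
    case False
    have "((\<lambda>y. 1 - excess y / K) \<longlongrightarrow> 1 - excess x / K) (at_right x)"
      by (intro tendsto_intros excess_tendsto_at_right) (use K_pos in simp)
    moreover have "\<forall>\<^sub>F y in at_right x. 1 - excess y / K = excess_cdf y"
      using False by (auto simp: eventually_at_right_field excess_cdf_def intro!: exI[of _ "x + 1"])
    ultimately have "(excess_cdf \<longlongrightarrow> 1 - excess x / K) (at_right x)"
      by (rule Lim_transform_eventually)
    then show ?thesis using False by (simp add: continuous_within excess_cdf_def)
  qed
next
  show "(excess_cdf \<longlongrightarrow> 0) at_bot"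
    by (rule tendsto_eventually) (auto simp: eventually_at_bot_dense excess_cdf_def intro!: exI[of _ 0])
next
  have "((\<lambda>y. 1 - excess y / K) \<longlongrightarrow> 1 - 0 / K) at_top"
    by (intro tendsto_intros excess_tendsto_0) (use K_pos in simp)
  moreover have "\<forall>\<^sub>F y in at_top. 1 - excess y / K = excess_cdf y"
    using eventually_ge_at_top[of 0] by eventually_elim (simp add: excess_cdf_def)
  ultimately show "(excess_cdf \<longlongrightarrow> 1) at_top"
    using Lim_transform_eventually by force
qed

abbreviation \<nu> :: "real measure" where "\<nu> \<equiv> interval_measure excess_cdf"

sublocale \<nu>: real_distribution \<nu>
  by (rule distribution_functionsD[OF excess_cdf_distribution])

lemma emeasure_excess_Ioc:
  assumes "y \<le> x" shows "emeasure \<nu> {y<..x} \<le> ennreal ((excess y - excess x) / K)"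
proof -
  have "emeasure \<nu> {y<..x} = ennreal (excess_cdf x - excess_cdf y)"
    using \<nu>.emeasure_Ioc[OF assms] distribution_functionsD(2)[OF excess_cdf_distribution] by simp
  then show ?thesis using excess_cdf_increment[OF assms] by (simp add: ennreal_leI)
qed

end

section \<open>Strong subexponentiality\<close>

lemma strong_subexponential_limits:
  assumes F: "F \<in> strong_subexponential"
  shows "((\<lambda>x. (\<integral>y. indicator {0..x / 2} y * tail F y \<partial>lborel)) \<longlongrightarrow> (LBINT y:{0..}. tail F y)) at_top"
    and "((\<lambda>x. (\<integral>y. indicator {0..x} y * (tail F (x - y) * tail F y) \<partial>lborel) / tail F x)
        \<longlongrightarrow> 2 * (LBINT y:{0..}. tail F y)) at_top"
proof -
  have Fd: "F \<in> distribution_functions" using F by (simp add: strong_subexponential_def)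
  note [measurable] = tail_measurable[OF Fd]
  have "((\<lambda>x. (\<integral>y. indicator {0..x / 2} y * tail F y \<partial>lborel)) \<longlongrightarrow>
      (\<integral>y. indicator {0..} y * tail F y \<partial>lborel)) at_top"
  proof (rule integral_dominated_convergence_at_top[where w="\<lambda>y. indicator {0..} y * tail F y"])
    show "integrable lborel (\<lambda>y. indicator {0..} y * tail F y)"
      using F by (simp add: strong_subexponential_def set_integrable_def)
    show "\<forall>\<^sub>F x in at_top. AE y in lborel. norm (indicator {0..x / 2} y * tail F y) \<le> indicator {0..} y * tail F y"
      using tail_bounds[OF Fd] by (auto simp: indicator_def)
    show "AE y in lborel. ((\<lambda>x. indicator {0..x / 2} y * tail F y) \<longlongrightarrow> indicator {0..} y * tail F y) at_top"
    proof (rule AE_I2)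
      fix y :: real
      show "((\<lambda>x. indicator {0..x / 2} y * tail F y) \<longlongrightarrow> indicator {0..} y * tail F y) at_top"
        by (rule tendsto_eventually)
          (use eventually_ge_at_top[of "2 * y"] in eventually_elim, auto simp: indicator_def)
    qed
  qed auto
  then show "((\<lambda>x. (\<integral>y. indicator {0..x / 2} y * tail F y \<partial>lborel)) \<longlongrightarrow> (LBINT y:{0..}. tail F y)) at_top"
    by (simp add: set_lebesgue_integral_def)
  show "((\<lambda>x. (\<integral>y. indicator {0..x} y * (tail F (x - y) * tail F y) \<partial>lborel) / tail F x)
        \<longlongrightarrow> 2 * (LBINT y:{0..}. tail F y)) at_top"
    using F by (simp add: strong_subexponential_def set_lebesgue_integral_def)
qed

lemma integrable_bounded_Icc:
  fixes f :: "real \<Rightarrow> real"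
  assumes [measurable]: "f \<in> borel_measurable borel" and "\<And>y. \<bar>f y\<bar> \<le> 1"
  shows "integrable lborel (\<lambda>y. indicator {a..b} y * f y)"
proof (rule Bochner_Integration.integrable_bound)
  show "integrable lborel (indicator {a..b} :: real \<Rightarrow> real)"
    by (rule integrable_real_indicator) (auto simp: emeasure_lborel_Icc_eq)
  show "AE y in lborel. norm (indicator {a..b} y * f y) \<le> norm (indicator {a..b} y :: real)"
    using assms(2) by (auto simp: indicator_def)
qed simp

text \<open>
In each half of \<open>[0, x]\<close> one factor of \<open>T (x - y) * T y\<close>, where \<open>T\<close> is the tail, is at least \<open>T x\<close>,
and the two halves contribute equally by the reflection \<open>y \<mapsto> x - y\<close>. For \<open>y\<close> in \<open>[A, 2 * A]\<close> the
first factor is even at least \<open>T (x - A)\<close>; recording this gain shows how far \<open>T (x - A)\<close> can exceed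
\<open>T x\<close> when the convolution is known to be close to its minimum.
\<close>

lemma self_convolution_lower_bound:
  assumes Fd: "F \<in> distribution_functions" and A: "0 < A" "4 * A \<le> x"
  shows "2 * (tail F x * (\<integral>y. indicator {0..x / 2} y * tail F y \<partial>lborel))
      + A * tail F (2 * A) * (tail F (x - A) - tail F x)
    \<le> (\<integral>y. indicator {0..x} y * (tail F (x - y) * tail F y) \<partial>lborel)"
proof -
  note [measurable] = tail_measurable[OF Fd]
  note tb = tail_bounds[OF Fd] and tm = tail_antimono[OF Fd]
  let ?T = "tail F"
  define h where "h y = indicator {0..x / 2} y * ?T y" for y
  have h_int: "integrable lborel h"
    unfolding h_def by (rule integrable_bounded_Icc) (use tb in auto)
  have h_refl: "integrable lborel (\<lambda>y. h (x - y))" "(\<integral>y. h (x - y) \<partial>lborel) = (\<integral>y. h y \<partial>lborel)"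
    using lborel_integrable_real_affine[OF h_int, of "-1" x] lborel_integral_real_affine[of "-1" h x] by auto
  have conv_int: "integrable lborel (\<lambda>y. indicator {0..x} y * (?T (x - y) * ?T y))"
    by (rule integrable_bounded_Icc) (use tb in \<open>auto simp: abs_mult intro: mult_le_one\<close>)
  have ind_int: "integrable lborel (indicator {A..2 * A} :: real \<Rightarrow> real)"
    by (rule integrable_real_indicator) (auto simp: emeasure_lborel_Icc_eq)
  let ?c = "?T (2 * A) * (?T (x - A) - ?T x)"
  have "(\<integral>y. ?T x * h y + ?T x * h (x - y) + ?c * indicator {A..2 * A} y \<partial>lborel)
    \<le> (\<integral>y. indicator {0..x} y * (?T (x - y) * ?T y) \<partial>lborel)"
  proof (rule integral_mono_AE)
    \<comment> \<open>The midpoint lies in both halves, and the bound may fail there.\<close>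
    have "AE y in lborel. y \<noteq> x / 2" by (rule AE_lborel_singleton)
    then show "AE y in lborel. ?T x * h y + ?T x * h (x - y) + ?c * indicator {A..2 * A} y
        \<le> indicator {0..x} y * (?T (x - y) * ?T y)"
    proof eventually_elim
      case (elim y)
      consider "y < 0" | "x < y" | "x / 2 < y" "y \<le> x" | "0 \<le> y" "y < A" | "A \<le> y" "y \<le> 2 * A"
        | "2 * A < y" "y < x / 2"
        using elim A by linarith
      then show ?case
      proof cases
        case 3
        have "?T x * ?T (x - y) \<le> ?T y * ?T (x - y)" using 3 tb tm by (intro mult_right_mono) auto
        then show ?thesis using 3 A by (simp add: h_def mult.commute)
      next
        case 4
        have "?T x * ?T y \<le> ?T (x - y) * ?T y" using 4 A tb tm by (intro mult_right_mono) auto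
        then show ?thesis using 4 A by (simp add: h_def)
      next
        case 6
        have "?T x * ?T y \<le> ?T (x - y) * ?T y" using 6 A tb tm by (intro mult_right_mono) auto
        then show ?thesis using 6 A by (simp add: h_def)
      next
        case 5
        have "?c \<le> ?T y * (?T (x - A) - ?T x)"
          using 5 A tb tm by (intro mult_right_mono) auto
        moreover have "?T (x - A) * ?T y \<le> ?T (x - y) * ?T y" using 5 A tb tm by (intro mult_right_mono) auto
        moreover have "h (x - y) = 0 \<or> y = x / 2" using 5 A by (auto simp: h_def)
        ultimately show ?thesis using elim 5 A by (simp add: h_def algebra_simps)
      qed (use A in \<open>auto simp: h_def\<close>)
    qed
  qed (use h_int h_refl conv_int ind_int in auto)
  also have "(\<integral>y. ?T x * h y + ?T x * h (x - y) + ?c * indicator {A..2 * A} y \<partial>lborel) =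
     2 * (?T x * (\<integral>y. h y \<partial>lborel)) + A * ?c"
    using h_int h_refl ind_int A by simp
  finally show ?thesis by (simp add: h_def mult.assoc)
qed

text \<open>
Strong subexponentiality says that the lower bound just shown is asymptotically sharp without its last
term; hence the last term is negligible against the tail, for every fixed \<open>A\<close>.
\<close>

lemma strong_subexponential_long_tailed:
  assumes F: "F \<in> strong_subexponential"
  shows "F \<in> long_tailed"
proof -
  have Fd: "F \<in> distribution_functions" and pos: "\<And>x. 0 < tail F x"
    using F by (auto simp: strong_subexponential_def)
  let ?N = "\<lambda>x. (\<integral>y. indicator {0..x} y * (tail F (x - y) * tail F y) \<partial>lborel) / tail F x"
  let ?I = "\<lambda>x. (\<integral>y. indicator {0..x / 2} y * tail F y \<partial>lborel)"
  have "((\<lambda>x. tail F (x + A) / tail F x) \<longlongrightarrow> 1) at_top" if A: "0 < A" for A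
  proof -
    let ?c = "A * tail F (2 * A)"
    have c: "0 < ?c" using A pos by simp
    have "((\<lambda>x. 1 + (?N x - 2 * ?I x) / ?c) \<longlongrightarrow>
        1 + (2 * (LBINT y:{0..}. tail F y) - 2 * (LBINT y:{0..}. tail F y)) / ?c) at_top"
      using c by (intro tendsto_intros strong_subexponential_limits[OF F]) auto
    then have upper: "((\<lambda>x. 1 + (?N x - 2 * ?I x) / ?c) \<longlongrightarrow> 1) at_top" by simp
    have "((\<lambda>x. tail F (x - A) / tail F x) \<longlongrightarrow> 1) at_top"
    proof (rule tendsto_sandwich[OF _ _ tendsto_const upper])
      show "\<forall>\<^sub>F x in at_top. 1 \<le> tail F (x - A) / tail F x"
        using pos A tail_antimono[OF Fd] by (intro always_eventually) (simp add: pos_le_divide_eq)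
      show "\<forall>\<^sub>F x in at_top. tail F (x - A) / tail F x \<le> 1 + (?N x - 2 * ?I x) / ?c"
        using eventually_ge_at_top[of "4 * A"]
      proof eventually_elim
        case (elim x)
        have "2 * (tail F x * ?I x) + ?c * (tail F (x - A) - tail F x) \<le> ?N x * tail F x"
          using self_convolution_lower_bound[OF Fd A elim] pos[of x] by simp
        then have "?c * (tail F (x - A) - tail F x) \<le> (?N x - 2 * ?I x) * tail F x"
          by (simp add: algebra_simps)
        then have "(?c * (tail F (x - A) - tail F x)) / tail F x \<le> ?N x - 2 * ?I x"
          using pos[of x] by (simp only: pos_divide_le_eq)
        then have "?c * (tail F (x - A) / tail F x - 1) \<le> ?N x - 2 * ?I x"
          using pos[of x] by (simp add: diff_divide_distrib right_diff_distrib less_imp_neq[symmetric])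
        then have "tail F (x - A) / tail F x - 1 \<le> (?N x - 2 * ?I x) / ?c"
          using c by (subst pos_le_divide_eq) (auto simp: mult.commute)
        then show ?case by linarith
      qed
    qed
    moreover have "filterlim (\<lambda>x. x + A) at_top at_top"
      using filterlim_tendsto_add_at_top[OF tendsto_const[of A] filterlim_ident] by (simp add: add.commute)
    ultimately have "((\<lambda>x. tail F (x + A - A) / tail F (x + A)) \<longlongrightarrow> 1) at_top"
      by (rule filterlim_compose)
    then have "((\<lambda>x. inverse (tail F x / tail F (x + A))) \<longlongrightarrow> inverse 1) at_top"
      by (intro tendsto_inverse) auto
    then show ?thesis by simp
  qed
  then show ?thesis using Fd pos by (simp add: long_tailed_def)
qed

lemma strong_subexponential_convolution_bound:
  assumes F: "F \<in> strong_subexponential"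
  obtains C where "0 < C" "\<forall>\<^sub>F x in at_top.
    (\<integral>\<^sup>+y. ennreal (tail F (x - y) * tail F y) * indicator {0..x} y \<partial>lborel) \<le> ennreal (C * tail F x)"
proof -
  have Fd: "F \<in> distribution_functions" and pos: "\<And>x. 0 < tail F x"
    using F by (auto simp: strong_subexponential_def)
  note [measurable] = tail_measurable[OF Fd]
  note tb = tail_bounds[OF Fd]
  define \<mu> where "\<mu> = (LBINT y:{0..}. tail F y)"
  have "0 \<le> \<mu>" unfolding \<mu>_def set_lebesgue_integral_def
    by (rule Bochner_Integration.integral_nonneg) (use tb in auto)
  show ?thesis
  proof (rule that[of "2 * \<mu> + 1"])
    let ?N = "\<lambda>x. (\<integral>y. indicator {0..x} y * (tail F (x - y) * tail F y) \<partial>lborel)"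
    have "\<forall>\<^sub>F x in at_top. ?N x / tail F x < 2 * \<mu> + 1"
      by (rule order_tendstoD(2)[OF strong_subexponential_limits(2)[OF F]]) (simp add: \<mu>_def)
    then show "\<forall>\<^sub>F x in at_top. (\<integral>\<^sup>+y. ennreal (tail F (x - y) * tail F y) * indicator {0..x} y \<partial>lborel)
        \<le> ennreal ((2 * \<mu> + 1) * tail F x)"
    proof eventually_elim
      case (elim x)
      have "(\<integral>\<^sup>+y. ennreal (tail F (x - y) * tail F y) * indicator {0..x} y \<partial>lborel) =
        (\<integral>\<^sup>+y. ennreal (indicator {0..x} y * (tail F (x - y) * tail F y)) \<partial>lborel)"
        by (intro nn_integral_cong) (auto simp: indicator_def)
      also have "\<dots> = ennreal (?N x)"
        by (intro nn_integral_eq_integral integrable_bounded_Icc)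
          (use tb in \<open>auto simp: abs_mult intro: mult_le_one\<close>)
      also have "\<dots> \<le> ennreal ((2 * \<mu> + 1) * tail F x)"
        using elim pos[of x] by (intro ennreal_leI) (simp add: pos_divide_less_eq)
      finally show ?case .
    qed
  qed (use \<open>0 \<le> \<mu>\<close> in simp)
qed

context weighted_tail begin

lemma cdf_distribution: "cdf \<mu> \<in> distribution_functions"
  using \<mu>.cdf_nondecreasing \<mu>.cdf_is_right_cont \<mu>.cdf_lim_at_bot \<mu>.cdf_lim_at_top_prob
  by (auto simp: distribution_functions_def mono_def)

section \<open>The contribution of the far mass to the convolution\<close>

text \<open>
The case of strong subexponentiality. Unit intervals satisfy \<open>\<nu> (y - 1, y] \<le> d * T y\<close> for large \<open>y\<close>,
by \<open>excess_decrement_small\<close>, so that \<open>\<nu>\<close> may be replaced by a measure of density \<open>d * T\<close>. To do so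
without discretising, \<open>T (x - u)\<close> is bounded by the integral of \<open>T (x - y)\<close> over \<open>y\<close> in \<open>[u, u + 1)\<close>,
and the order of integration is exchanged. What results is \<open>d\<close> times the convolution of \<open>T\<close> with
itself, which is of the order of \<open>T x\<close>, and an overhang over \<open>[x, x + 1]\<close>.
\<close>

lemma far_mass_small_strong_subexponential:
  assumes S: "cdf \<mu> \<in> strong_subexponential" and e: "0 < \<epsilon>"
  shows "\<exists>A. \<forall>\<^sub>F x in at_top.
      (\<integral>\<^sup>+u. ennreal (T (x - u)) * indicator {A<..x} u \<partial>\<nu>) \<le> ennreal (\<epsilon> * T x)"
proof -
  note tb = tail_bounds[OF cdf_distribution] and tm = tail_antimono[OF cdf_distribution]
  interpret P: pair_sigma_finite \<nu> lborel ..
  obtain C where C: "0 < C" "\<forall>\<^sub>F x in at_top.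
    (\<integral>\<^sup>+y. ennreal (T (x - y) * T y) * indicator {0..x} y \<partial>lborel) \<le> ennreal (C * T x)"
    using strong_subexponential_convolution_bound[OF S] .
  \<comment> \<open>The overhang accounts for the additional \<open>1\<close>.\<close>
  define d where "d = \<epsilon> / (C + 1)"
  have d: "0 < d" using e C by (simp add: d_def)
  obtain A where A: "0 \<le> A" "\<And>y. A \<le> y \<Longrightarrow> emeasure \<nu> {y - 1<..y} \<le> ennreal (d * T y)"
  proof -
    have "\<forall>\<^sub>F x in at_top. excess (x - 1) - excess x \<le> (d * K) * T x"
      using d K_pos by (intro excess_decrement_small strong_subexponential_long_tailed S) auto
    then obtain A where A: "\<And>y. A \<le> y \<Longrightarrow> excess (y - 1) - excess y \<le> (d * K) * T y"
      by (auto simp: eventually_at_top_linorder)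
    show ?thesis
    proof (rule that[of "max A 0"])
      fix y assume "max A 0 \<le> y"
      then have "(excess (y - 1) - excess y) / K \<le> d * T y"
        using A[of y] K_pos by (simp add: pos_divide_le_eq algebra_simps)
      then show "emeasure \<nu> {y - 1<..y} \<le> ennreal (d * T y)"
        by (intro order_trans[OF emeasure_excess_Ioc] ennreal_leI) auto
    qed simp
  qed
  have "\<forall>\<^sub>F x in at_top. (\<integral>\<^sup>+u. ennreal (T (x - u)) * indicator {A<..x} u \<partial>\<nu>) \<le> ennreal (\<epsilon> * T x)"
    using C(2)
  proof eventually_elim
    case (elim x)
    have "(\<integral>\<^sup>+u. ennreal (T (x - u)) * indicator {A<..x} u \<partial>\<nu>) \<le>
      (\<integral>\<^sup>+u. \<integral>\<^sup>+y. ennreal (T (x - y)) * (indicator {A<..x} u * (indicator {u..} y * indicator {..<u + 1} y)) \<partial>lborel \<partial>\<nu>)"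
    proof (rule nn_integral_mono)
      fix u
      have "ennreal (T (x - u)) * indicator {A<..x} u =
        (\<integral>\<^sup>+y. ennreal (T (x - u)) * indicator {A<..x} u * indicator {u..<u + 1} y \<partial>lborel)"
        by (subst nn_integral_cmult_indicator) auto
      also have "\<dots> \<le> (\<integral>\<^sup>+y. ennreal (T (x - y)) * (indicator {A<..x} u * (indicator {u..} y * indicator {..<u + 1} y)) \<partial>lborel)"
        by (intro nn_integral_mono) (auto simp: indicator_def intro!: ennreal_leI tm)
      finally show "ennreal (T (x - u)) * indicator {A<..x} u \<le> \<dots>" .
    qed
    also have "\<dots> = (\<integral>\<^sup>+y. \<integral>\<^sup>+u. ennreal (T (x - y)) * (indicator {A<..x} u * (indicator {u..} y * indicator {..<u + 1} y)) \<partial>\<nu> \<partial>lborel)"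
      by (rule P.Fubini'[symmetric]) (simp add: indicator_def)
    also have "\<dots> \<le> (\<integral>\<^sup>+y. ennreal d * (ennreal (T (x - y) * T y) * indicator {0..x} y) + 
        ennreal d * (ennreal (T x) * indicator {x..x + 1} y) \<partial>lborel)"
    proof (rule nn_integral_mono)
      fix y
      have "(\<integral>\<^sup>+u. ennreal (T (x - y)) * (indicator {A<..x} u * (indicator {u..} y * indicator {..<u + 1} y)) \<partial>\<nu>)
         \<le> (\<integral>\<^sup>+u. ennreal (T (x - y)) * indicator {A..x + 1} y * indicator {y - 1<..y} u \<partial>\<nu>)"
        by (intro nn_integral_mono) (auto simp: indicator_def)
      also have "\<dots> = ennreal (T (x - y)) * indicator {A..x + 1} y * emeasure \<nu> {y - 1<..y}"
        by (rule nn_integral_cmult_indicator) simp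
      also have "\<dots> \<le> ennreal (T (x - y)) * indicator {A..x + 1} y * ennreal (d * T y)"
        using A(2)[of y] by (cases "A \<le> y") (auto intro: mult_left_mono)
      also have "\<dots> = ennreal d * ennreal (T (x - y) * T y) * indicator {A..x + 1} y"
        using d tb by (simp add: ennreal_mult mult_ac)
      also have "\<dots> \<le> ennreal d * (ennreal (T (x - y) * T y) * indicator {0..x} y) + 
        ennreal d * (ennreal (T x) * indicator {x..x + 1} y)"
      proof -
        have "T (x - y) * T y \<le> T x" if "x \<le> y"
          using mult_mono[of "T (x - y)" 1 "T y" "T x"] tb tm[OF that] by simp
        then show ?thesis using A(1)
          by (cases "x \<le> y") (auto simp: indicator_def intro!: add_increasing mult_left_mono ennreal_leI)
      qed
      finally show "(\<integral>\<^sup>+u. ennreal (T (x - y)) * (indicator {A<..x} u * (indicator {u..} y * indicator {..<u + 1} y)) \<partial>\<nu>) \<le> \<dots>" .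
    qed
    also have "\<dots> = ennreal d * (\<integral>\<^sup>+y. ennreal (T (x - y) * T y) * indicator {0..x} y \<partial>lborel)
        + ennreal d * ennreal (T x)"
      by (simp add: nn_integral_add nn_integral_cmult nn_integral_cmult_indicator)
    also have "\<dots> \<le> ennreal d * ennreal (C * T x) + ennreal d * ennreal (T x)"
      by (intro add_right_mono mult_left_mono elim) auto
    also have "\<dots> = ennreal (d * (C + 1) * T x)"
      using d C(1) tb by (simp add: ennreal_mult[symmetric] ennreal_plus[symmetric] algebra_simps del: ennreal_plus)
    also have "d * (C + 1) = \<epsilon>" using C(1) by (simp add: d_def)
    finally show ?case .
  qed
  then show ?thesis by blast
qed

text \<open>
The case of dominated variation, where the tail need not be integrable. The integral is the mass, under
\<open>\<nu> \<Otimes>\<^sub>M \<mu>\<close>, of the pairs \<open>(u, w)\<close> with \<open>A < u \<le> x < u + w\<close>, and it is split according to \<open>w\<close>. If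
\<open>w \<le> B\<close>, then \<open>u\<close> lies in \<open>(x - B, x]\<close>, which has negligible mass by \<open>excess_decrement_small\<close>. If
\<open>w > x / 2\<close>, the mass is at most \<open>T (x / 2)\<close> times that of \<open>(A, \<infinity>)\<close>. In between, the mass of
\<open>(x - w, x]\<close> is at most \<open>r w * T (x / 2) / K\<close> by \<open>excess_decrement_le\<close>, and integrating over
\<open>w > B\<close> yields a tail of the convergent integral of \<open>r\<close>. Finally \<open>T (x / 2)\<close> is of the order of \<open>T x\<close>.
\<close>

lemma far_mass_small_dominated:
  assumes L: "cdf \<mu> \<in> long_tailed" and D: "cdf \<mu> \<in> dominated_varying" and e: "0 < \<epsilon>"
  shows "\<exists>A. \<forall>\<^sub>F x in at_top.
      (\<integral>\<^sup>+u. ennreal (T (x - u)) * indicator {A<..x} u \<partial>\<nu>) \<le> ennreal (\<epsilon> * T x)"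
proof -
  note tb = tail_bounds[OF cdf_distribution] and tm = tail_antimono[OF cdf_distribution]
  interpret P: pair_sigma_finite \<nu> \<mu> ..
  obtain C where C: "0 < C" "\<And>x. 0 < x \<Longrightarrow> T (x / 2) \<le> C * T x"
  proof -
    obtain C where C: "\<And>x. 0 < x \<Longrightarrow> T (x / 2) / T x \<le> C"
      using D by (auto simp: dominated_varying_def bdd_above_def)
    then have "T (x / 2) \<le> max C 1 * T x" if "0 < x" for x
      using C[OF that] tail_pos[of x] by (subst pos_divide_le_eq[symmetric]) auto
    then show ?thesis by (intro that[of "max C 1"]) auto
  qed
  \<comment> \<open>Each of the three ranges of \<open>w\<close> is to contribute at most a third of \<open>\<epsilon> * T x\<close>.\<close>
  define d where "d = \<epsilon> / (3 * C)"
  have d: "0 < d" using C e by (simp add: d_def)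
  obtain B where B: "0 < B" "(\<integral>w. r w * indicator {B<..} w \<partial>\<mu>) \<le> d * K"
  proof -
    have "((\<lambda>B. \<integral>w. r w * indicator {B<..} w \<partial>\<mu>) \<longlongrightarrow> (\<integral>w. 0 \<partial>\<mu>)) at_top"
    proof (rule integral_dominated_convergence_at_top[where w=r])
      show "AE w in \<mu>. ((\<lambda>B. r w * indicator {B<..} w) \<longlongrightarrow> 0) at_top"
      proof (rule AE_I2)
        fix w show "((\<lambda>B. r w * indicator {B<..} w) \<longlongrightarrow> 0) at_top"
          by (rule tendsto_eventually) (use eventually_ge_at_top[of w] in eventually_elim, simp)
      qed
    qed (auto simp: r_int r_nonneg indicator_def)
    then have "\<forall>\<^sub>F B in at_top. (\<integral>w. r w * indicator {B<..} w \<partial>\<mu>) < d * K"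
      by (rule order_tendstoD(2)) (use d K_pos in simp)
    with eventually_gt_at_top[of 0] 
    have "\<forall>\<^sub>F B in at_top. 0 < B \<and> (\<integral>w. r w * indicator {B<..} w \<partial>\<mu>) < d * K"
      by eventually_elim simp
    then show ?thesis using that by (auto simp: eventually_at_top_linorder intro: less_imp_le)
  qed
  obtain A where A: "tail excess_cdf A \<le> d"
  proof -
    have "\<forall>\<^sub>F A in at_top. tail excess_cdf A < d"
      by (rule order_tendstoD(2)[OF tail_tendsto_0[OF excess_cdf_distribution] d])
    then show ?thesis using that by (auto simp: eventually_at_top_linorder intro: less_imp_le)
  qed
  have "\<forall>\<^sub>F x in at_top. excess (x - B) - excess x \<le> (\<epsilon> / 3 * K) * T x"
    using e K_pos by (intro excess_decrement_small L B) auto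
  with eventually_gt_at_top[of 0]
  have "\<forall>\<^sub>F x in at_top. (\<integral>\<^sup>+u. ennreal (T (x - u)) * indicator {A<..x} u \<partial>\<nu>) \<le> ennreal (\<epsilon> * T x)"
  proof eventually_elim
    case (elim x)
    let ?f = "\<lambda>u w. indicator {..x} u * indicator {B<..x / 2} w * indicator {x<..} (u + w) :: ennreal"
    have "(\<integral>\<^sup>+u. ennreal (T (x - u)) * indicator {A<..x} u \<partial>\<nu>) \<le>
      (\<integral>\<^sup>+u. indicator {x - B<..x} u + (ennreal (T (x / 2)) * indicator {A<..} u + (\<integral>\<^sup>+w. ?f u w \<partial>\<mu>)) \<partial>\<nu>)"
    proof (rule nn_integral_mono)
      fix u
      show "ennreal (T (x - u)) * indicator {A<..x} u \<le> 
          indicator {x - B<..x} u + (ennreal (T (x / 2)) * indicator {A<..} u + (\<integral>\<^sup>+w. ?f u w \<partial>\<mu>))"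
      proof (cases "A < u \<and> u \<le> x - B")
        case True
        then have u: "A < u" "u \<le> x - B" by auto
        have "ennreal (T (x - u)) = emeasure \<mu> {x - u<..}" by (simp add: \<mu>.emeasure_tail)
        also have "\<dots> \<le> emeasure \<mu> ({x / 2<..} \<union> {x - u<..x / 2})" by (intro emeasure_mono) auto
        also have "\<dots> \<le> emeasure \<mu> {x / 2<..} + emeasure \<mu> {x - u<..x / 2}"
          by (intro emeasure_subadditive) auto
        also have "emeasure \<mu> {x - u<..x / 2} = (\<integral>\<^sup>+w. indicator {x - u<..x / 2} w \<partial>\<mu>)" by simp
        also have "\<dots> \<le> (\<integral>\<^sup>+w. ?f u w \<partial>\<mu>)"
          using u B by (intro nn_integral_mono) (auto simp: indicator_def)
        finally have "ennreal (T (x - u)) \<le> ennreal (T (x / 2)) + (\<integral>\<^sup>+w. ?f u w \<partial>\<mu>)"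
          by (simp add: \<mu>.emeasure_tail add_left_mono)
        then show ?thesis using u B by simp
      next
        case False
        then show ?thesis using tb[of "x - u"]
          by (cases "u \<in> {A<..x}") (auto simp: indicator_def intro!: add_increasing2)
      qed
    qed
    also have "\<dots> = emeasure \<nu> {x - B<..x} + (ennreal (T (x / 2)) * emeasure \<nu> {A<..}
        + (\<integral>\<^sup>+u. \<integral>\<^sup>+w. ?f u w \<partial>\<mu> \<partial>\<nu>))"
      by (subst nn_integral_add, simp, simp)+ (simp add: nn_integral_cmult_indicator)
    also have "(\<integral>\<^sup>+u. \<integral>\<^sup>+w. ?f u w \<partial>\<mu> \<partial>\<nu>) = (\<integral>\<^sup>+w. \<integral>\<^sup>+u. ?f u w \<partial>\<nu> \<partial>\<mu>)"
      by (rule P.Fubini'[symmetric]) simp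
    also have "\<dots> \<le> (\<integral>\<^sup>+w. ennreal (T (x / 2) / K * (r w * indicator {B<..} w)) \<partial>\<mu>)"
    proof (rule nn_integral_mono)
      fix w
      have "(\<integral>\<^sup>+u. ?f u w \<partial>\<nu>) = (\<integral>\<^sup>+u. indicator {B<..x / 2} w * indicator {x - w<..x} u \<partial>\<nu>)"
        by (intro nn_integral_cong) (auto simp: indicator_def)
      also have "\<dots> = indicator {B<..x / 2} w * emeasure \<nu> {x - w<..x}"
        by (rule nn_integral_cmult_indicator) simp
      also have "\<dots> \<le> ennreal (T (x / 2) / K * (r w * indicator {B<..} w))"
      proof (cases "w \<in> {B<..x / 2}")
        case True
        then have w: "B < w" "w \<le> x / 2" by auto
        have "(excess (x - w) - excess x) / K \<le> r w * T (x - w) / K"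
          using w B K_pos by (intro divide_right_mono excess_decrement_le) auto
        also have "\<dots> \<le> r w * T (x / 2) / K"
          using w K_pos r_nonneg tm by (intro divide_right_mono mult_left_mono) auto
        finally show ?thesis using w B emeasure_excess_Ioc[of "x - w" x]
          by (auto simp: mult_ac intro: order_trans ennreal_leI)
      qed simp
      finally show "(\<integral>\<^sup>+u. ?f u w \<partial>\<nu>) \<le> ennreal (T (x / 2) / K * (r w * indicator {B<..} w))" .
    qed
    also have "\<dots> = ennreal (T (x / 2) / K * (\<integral>w. r w * indicator {B<..} w \<partial>\<mu>))"
    proof -
      have "integrable \<mu> (\<lambda>w. r w * indicator {B<..} w)"
        by (rule integrable_real_mult_indicator) (auto simp: r_int)
      then show ?thesis using tb K_pos r_nonneg
        by (subst nn_integral_eq_integral) auto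
    qed
    also have "\<dots> \<le> ennreal (T (x / 2) / K * (d * K))"
      using tb K_pos B by (intro ennreal_leI mult_left_mono) auto
    also have "emeasure \<nu> {A<..} \<le> ennreal d"
      using A \<nu>.emeasure_tail[of A] distribution_functionsD(2)[OF excess_cdf_distribution]
      by (simp add: ennreal_leI)
    also have "emeasure \<nu> {x - B<..x} \<le> ennreal (\<epsilon> / 3 * T x)"
      using elim(2) B K_pos by (intro order_trans[OF emeasure_excess_Ioc] ennreal_leI)
        (auto simp: pos_divide_le_eq algebra_simps)
    finally have "(\<integral>\<^sup>+u. ennreal (T (x - u)) * indicator {A<..x} u \<partial>\<nu>) \<le>
        ennreal (\<epsilon> / 3 * T x) + (ennreal (T (x / 2)) * ennreal d + ennreal (T (x / 2) / K * (d * K)))"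
      by (simp add: add_mono mult_left_mono)
    also have "\<dots> = ennreal (\<epsilon> / 3 * T x + 2 * d * T (x / 2))"
      using tb d e K_pos by (simp add: ennreal_mult[symmetric] ennreal_plus[symmetric] algebra_simps del: ennreal_plus)
    also have "\<dots> \<le> ennreal (\<epsilon> * T x)"
    proof (rule ennreal_leI)
      have "2 * d * T (x / 2) \<le> 2 * d * (C * T x)" using d C(2)[OF elim(1)] by (intro mult_left_mono) auto
      also have "\<dots> = 2 * \<epsilon> / 3 * T x" using C(1) by (simp add: d_def)
      finally show "\<epsilon> / 3 * T x + 2 * d * T (x / 2) \<le> \<epsilon> * T x" by (simp add: algebra_simps)
    qed
    finally show ?case .
  qed
  then show ?thesis by blast
qed

theorem excess_cdf_in_S_class:
  assumes "cdf \<mu> \<in> strong_subexponential \<or> cdf \<mu> \<in> long_tailed \<inter> dominated_varying"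
  shows "excess_cdf \<in> S_class (cdf \<mu>)"
proof (rule S_classI)
  show "cdf \<mu> \<in> long_tailed" using assms strong_subexponential_long_tailed by blast
  show "\<exists>A. \<forall>\<^sub>F x in at_top.
      (\<integral>\<^sup>+u. ennreal (T (x - u)) * indicator {A<..x} u \<partial>\<nu>) \<le> ennreal (\<epsilon> * T x)" if "0 < \<epsilon>" for \<epsilon>
    using assms far_mass_small_strong_subexponential far_mass_small_dominated that by blast
qed (auto simp: excess_cdf_distribution excess_cdf_def)

end

section \<open>The weight given by the truncated mean\<close>

lemma integrable_positive_part:
  assumes \<mu>: "real_distribution \<mu>" and T: "set_integrable lborel {0..} (tail (cdf \<mu>))"
  shows "integrable \<mu> (\<lambda>t. max t 0)"
proof -
  interpret real_distribution \<mu> by fact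
  interpret P: pair_sigma_finite \<mu> lborel ..
  have "(\<integral>\<^sup>+t. ennreal (max t 0) \<partial>\<mu>) = (\<integral>\<^sup>+t. \<integral>\<^sup>+y. indicator {0..} y * indicator {y<..} t \<partial>lborel \<partial>\<mu>)"
  proof (rule nn_integral_cong)
    fix t :: real
    have "(\<integral>\<^sup>+y. indicator {0..} y * indicator {y<..} t \<partial>lborel) = (\<integral>\<^sup>+y. indicator {0..<t} y \<partial>lborel)"
      by (intro nn_integral_cong) (auto simp: indicator_def)
    also have "\<dots> = ennreal (max t 0)" by (cases "0 \<le> t") (auto simp: max_def)
    finally show "ennreal (max t 0) = (\<integral>\<^sup>+y. indicator {0..} y * indicator {y<..} t \<partial>lborel)" by simp
  qed
  also have "\<dots> = (\<integral>\<^sup>+y. \<integral>\<^sup>+t. indicator {0..} y * indicator {y<..} t \<partial>\<mu> \<partial>lborel)"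
    by (rule P.Fubini'[symmetric]) (simp add: indicator_def)
  also have "\<dots> = (\<integral>\<^sup>+y. ennreal (norm (indicator {0..} y * tail (cdf \<mu>) y)) \<partial>lborel)"
  proof (rule nn_integral_cong)
    fix y :: real
    have "(\<integral>\<^sup>+t. indicator {0..} y * indicator {y<..} t \<partial>\<mu>) = indicator {0..} y * emeasure \<mu> {y<..}"
      by (rule nn_integral_cmult_indicator) simp
    then show "(\<integral>\<^sup>+t. indicator {0..} y * indicator {y<..} t \<partial>\<mu>) =
        ennreal (norm (indicator {0..} y * tail (cdf \<mu>) y))"
      by (simp add: emeasure_tail tail_cdf_bounds indicator_def)
  qed
  also have "\<dots> < \<infinity>"
    using T by (simp add: set_integrable_def integrable_iff_bounded)
  finally show ?thesis by (intro integrableI_nonneg) auto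
qed

text \<open>
Since \<open>m\<close> is increasing, \<open>(s + w) / m (s + w)\<close> is at most both \<open>s / m s + w / m w\<close>, which is
subadditivity, and \<open>s / m s + w / m s\<close>, whose last term vanishes as \<open>m\<close> tends to infinity. The ratio
condition, which makes \<open>s / m s\<close> increasing, is concavity of \<open>m\<close> as seen from the origin.
Integrability may be proved with monotonicity at hand, which supplies measurability.
\<close>

lemma weighted_tail_quotient:
  fixes m :: "real \<Rightarrow> real"
  defines "r \<equiv> \<lambda>s. if 0 < s then s / m s else 0"
  assumes \<mu>: "real_distribution \<mu>" and tail_pos: "\<And>x. 0 < tail (cdf \<mu>) x"
    and m_pos: "\<And>s. 0 < s \<Longrightarrow> 0 < m s"
    and m_mono: "\<And>s t. 0 < s \<Longrightarrow> s \<le> t \<Longrightarrow> m s \<le> m t"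
    and m_ratio: "\<And>s t. 0 < s \<Longrightarrow> s \<le> t \<Longrightarrow> s * m t \<le> t * m s"
    and m_cont: "continuous_on {0<..} m"
    and m_top: "filterlim m at_top at_top"
    and int: "mono r \<Longrightarrow> integrable \<mu> r"
  shows "weighted_tail \<mu> r"
proof -
  have r_le: "s / m s \<le> t / m t" if "0 < s" "s \<le> t" for s t
    using m_ratio[OF that] m_pos[of s] m_pos[of t] that by (simp add: field_simps)
  have mono: "mono r"
  proof (rule monoI)
    fix s t :: real assume "s \<le> t"
    then show "r s \<le> r t" using r_le[of s t] m_pos[of t] by (auto simp: r_def)
  qed
  have incr: "(s + w) / m (s + w) \<le> s / m s + w / m s" if "0 < s" "0 < w" for s w
    using m_mono[of s "s + w"] m_pos[of s] that
    by (simp add: add_divide_distrib[symmetric] frac_le)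
  show ?thesis
  proof (intro weighted_tail.intro weighted_tail_axioms.intro \<mu> tail_pos mono int[OF mono])
    show "continuous_on {0<..} r"
    proof (rule continuous_on_eq)
      show "continuous_on {0<..} (\<lambda>s. s / m s)"
        using m_pos by (intro continuous_intros m_cont) (auto simp: less_imp_neq[symmetric])
    qed (simp add: r_def)
    show "r (s + w) \<le> r s + r w" if "0 < s" "0 < w" for s w
    proof -
      have "(s + w) / m (s + w) = s / m (s + w) + w / m (s + w)" by (simp add: add_divide_distrib)
      also have "\<dots> \<le> s / m s + w / m w"
        using m_mono[of s "s + w"] m_mono[of w "s + w"] m_pos[of s] m_pos[of w] that
        by (intro add_mono divide_left_mono mult_pos_pos m_pos) auto
      finally show ?thesis using that by (simp add: r_def)
    qed
    show "((\<lambda>s. r (s + w) - r s) \<longlongrightarrow> 0) at_top" if w: "0 < w" for w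
    proof (rule tendsto_sandwich[OF _ _ tendsto_const])
      show "\<forall>\<^sub>F s in at_top. 0 \<le> r (s + w) - r s"
        using w by (intro always_eventually) (auto intro: monoD[OF mono])
      show "\<forall>\<^sub>F s in at_top. r (s + w) - r s \<le> w / m s"
        using eventually_gt_at_top[of 0]
      proof eventually_elim
        case (elim s)
        then show ?case using incr[of s w] w by (simp add: r_def)
      qed
      show "((\<lambda>s. w / m s) \<longlongrightarrow> 0) at_top"
        by (rule tendsto_divide_0[OF tendsto_const filterlim_at_top_imp_at_infinity[OF m_top]])
    qed
  qed (auto simp: r_def m_pos)
qed

context prob_space begin

context
  fixes X :: "'a \<Rightarrow> real" and m :: "real \<Rightarrow> real"
  assumes X [measurable]: "random_variable borel X"
  defines "m \<equiv> truncated_neg_mean M X"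
begin

lemma integrable_truncated:
  "0 \<le> x \<Longrightarrow> integrable M (\<lambda>\<omega>. min (max (- X \<omega>) 0) x)"
  by (rule integrable_const_bound[where B=x]) auto

lemma truncated_neg_mean_mono: "0 \<le> s \<Longrightarrow> s \<le> t \<Longrightarrow> m s \<le> m t"
  unfolding m_def truncated_neg_mean_def by (intro integral_mono integrable_truncated) auto

lemma truncated_neg_mean_lipschitz:
  assumes "0 \<le> s" "s \<le> t" shows "m t - m s \<le> t - s"
proof -
  have "m t \<le> (\<integral>\<omega>. min (max (- X \<omega>) 0) s + (t - s) \<partial>M)"
    unfolding m_def truncated_neg_mean_def using assms integrable_truncated[of s]
    by (intro integral_mono integrable_truncated) auto
  also have "\<dots> = m s + (t - s)"
    using assms integrable_truncated[of s] prob_space by (simp add: m_def truncated_neg_mean_def)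
  finally show ?thesis by simp
qed

lemma truncated_neg_mean_ratio:
  assumes "0 < s" "s \<le> t" shows "s * m t \<le> t * m s"
proof -
  have "(\<integral>\<omega>. s * min (max (- X \<omega>) 0) t \<partial>M) \<le> (\<integral>\<omega>. t * min (max (- X \<omega>) 0) s \<partial>M)"
  proof (rule integral_mono)
    fix \<omega>
    show "s * min (max (- X \<omega>) 0) t \<le> t * min (max (- X \<omega>) 0) s"
      using assms mult_right_mono[of s t "max (- X \<omega>) 0"]
        mult_left_mono[of "max (- X \<omega>) 0" t s] by (auto simp: min_def mult.commute)
  qed (use assms integrable_truncated in auto)
  then show ?thesis by (simp add: m_def truncated_neg_mean_def)
qed

text \<open>
Monotone convergence; this is how the infinite negative mean enters the argument.
\<close>

lemma truncated_neg_mean_at_top: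
  assumes inf: "(\<integral>\<^sup>+\<omega>. ennreal (max (- X \<omega>) 0) \<partial>M) = \<infinity>"
  shows "filterlim m at_top at_top"
proof (rule ccontr)
  assume "\<not> ?thesis"
  then obtain C where C: "\<not> (\<forall>\<^sub>F x in at_top. C \<le> m x)"
    by (auto simp: filterlim_at_top)
  have bound: "m (real n) \<le> C" for n
  proof (rule ccontr)
    assume "\<not> m (real n) \<le> C"
    then have "C \<le> m x" if "real n \<le> x" for x
      using truncated_neg_mean_mono[of "real n" x] that by simp
    then show False using C by (auto simp: eventually_at_top_linorder)
  qed
  have "(\<lambda>n. \<integral>\<^sup>+\<omega>. ennreal (min (max (- X \<omega>) 0) (real n)) \<partial>M) \<longlonglongrightarrow> (\<integral>\<^sup>+\<omega>. ennreal (max (- X \<omega>) 0) \<partial>M)"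
  proof (rule nn_integral_LIMSEQ)
    show "incseq (\<lambda>n \<omega>. ennreal (min (max (- X \<omega>) 0) (real n)))"
      by (auto simp: incseq_def le_fun_def intro!: ennreal_leI)
    fix \<omega>
    obtain n0 where n0: "max (- X \<omega>) 0 \<le> real n0" using real_arch_simple by blast
    show "(\<lambda>n. ennreal (min (max (- X \<omega>) 0) (real n))) \<longlonglongrightarrow> ennreal (max (- X \<omega>) 0)"
    proof (rule tendsto_eventually)
      show "\<forall>\<^sub>F n in sequentially. ennreal (min (max (- X \<omega>) 0) (real n)) = ennreal (max (- X \<omega>) 0)"
        using eventually_ge_at_top[of n0] by eventually_elim (use n0 in \<open>auto simp: min_def\<close>)
    qed
  qed auto
  moreover have "(\<integral>\<^sup>+\<omega>. ennreal (min (max (- X \<omega>) 0) (real n)) \<partial>M) \<le> ennreal C" for n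
  proof -
    have "(\<integral>\<^sup>+\<omega>. ennreal (min (max (- X \<omega>) 0) (real n)) \<partial>M) = ennreal (m (real n))"
      unfolding m_def truncated_neg_mean_def
      by (intro nn_integral_eq_integral integrable_truncated) auto
    then show ?thesis using bound by (simp add: ennreal_leI)
  qed
  ultimately have "(\<integral>\<^sup>+\<omega>. ennreal (max (- X \<omega>) 0) \<partial>M) \<le> ennreal C"
    by (intro LIMSEQ_le_const2) auto
  then show False using inf by (simp add: top_unique)
qed

text \<open>
By the ratio inequality, positivity at one large argument is inherited by all smaller ones.
\<close>

lemma truncated_neg_mean_pos:
  assumes inf: "(\<integral>\<^sup>+\<omega>. ennreal (max (- X \<omega>) 0) \<partial>M) = \<infinity>" and s: "0 < s"
  shows "0 < m s"
proof -
  have "\<forall>\<^sub>F t in at_top. s \<le> t \<and> 0 < m t"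
    using truncated_neg_mean_at_top[OF inf] eventually_ge_at_top[of s]
    by (auto simp: filterlim_at_top_dense intro: eventually_conj)
  then obtain t where t: "s \<le> t" "0 < m t" by (auto simp: eventually_at_top_linorder)
  then have "0 < s * m t" using s by simp
  also have "\<dots> \<le> t * m s" by (rule truncated_neg_mean_ratio[OF s t(1)])
  finally show ?thesis using s t(1) by (simp add: zero_less_mult_iff)
qed

lemma truncated_neg_mean_continuous: "continuous_on {0<..} m"
proof (rule continuous_onI)
  fix x e :: real assume "x \<in> {0<..}" "0 < e"
  show "\<exists>d>0. \<forall>x'\<in>{0<..}. dist x' x < d \<longrightarrow> dist (m x') (m x) \<le> e"
  proof (intro exI[of _ e] conjI ballI impI \<open>0 < e\<close>)
    fix y assume y: "y \<in> {0<..}" "dist y x < e"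
    show "dist (m y) (m x) \<le> e"
      using y \<open>x \<in> {0<..}\<close> truncated_neg_mean_lipschitz[of x y] truncated_neg_mean_lipschitz[of y x]
        truncated_neg_mean_mono[of x y] truncated_neg_mean_mono[of y x]
      by (cases "x \<le> y") (auto simp: dist_real_def)
  qed
qed

end
end

section \<open>The theorem\<close>

theorem theorem8:
  fixes M :: "'a measure" and \<xi> :: "'a \<Rightarrow> real" and F m :: "real \<Rightarrow> real"
  assumes "prob_space M"
    and "\<xi> \<in> borel_measurable M"
  defines "F \<equiv> cdf (distr M borel \<xi>)"
    and "m \<equiv> truncated_neg_mean M \<xi>"
  assumes "(\<integral>\<^sup>+\<omega>. ennreal (max (- \<xi> \<omega>) 0) \<partial>M) = \<infinity>"
    and "F \<in> strong_subexponential \<or>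
         (F \<in> long_tailed \<inter> dominated_varying \<and> K_const F m < \<infinity>)"
  shows "G1 F m \<in> S_class F"
proof -
  interpret prob_space M by fact
  note \<xi> = assms(2)
  note inf = assms(5)
  note cases = assms(6)
  let ?\<mu> = "distr M borel \<xi>"
  interpret \<mu>: real_distribution ?\<mu> using \<xi> by simp
  have Fd: "F \<in> distribution_functions" and pos: "0 < tail F x" for x
    using cases by (auto simp: strong_subexponential_def long_tailed_def)
  have im: "interval_measure F = ?\<mu>"
    by (rule cdf_unique[OF distribution_functionsD(1)[OF Fd] \<mu>.real_distribution_axioms])
      (simp add: distribution_functionsD(2)[OF Fd], simp add: F_def)
  define r where "r = (\<lambda>s. if 0 < s then s / m s else 0)"
  have m_pos: "0 < m s" if "0 < s" for s
    using truncated_neg_mean_pos[OF \<xi> inf that] by (simp add: m_def)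
  have r_nonneg: "0 \<le> r s" for s using m_pos[of s] by (auto simp: r_def)
  have r_shift: "(\<integral>\<^sup>+t\<in>{x<..}. ennreal ((t - x) / m (t - x)) \<partial>?\<mu>) = (\<integral>\<^sup>+t. ennreal (r (t - x)) \<partial>?\<mu>)" for x
    by (intro nn_integral_cong) (auto simp: r_def indicator_def)
  \<comment> \<open>If \<open>F\<close> is strongly subexponential, \<open>r\<close> grows at most linearly and \<open>max \<xi> 0\<close> has finite mean; in
    the other case integrability is the finiteness of the normalising constant.\<close>
  have int: "integrable ?\<mu> r" if "mono r"
  proof -
    have [measurable]: "r \<in> borel_measurable borel" using that by (rule borel_measurable_mono)
    show ?thesis using cases
    proof
      assume "F \<in> strong_subexponential"
      then have "set_integrable lborel {0..} (tail (cdf ?\<mu>))"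
        by (simp add: strong_subexponential_def F_def)
      then have "integrable ?\<mu> (\<lambda>t. max t 0 / m 1 + 1 / m 1)"
        using integrable_positive_part[OF \<mu>.real_distribution_axioms] by simp
      then show "integrable ?\<mu> r"
      proof (rule Bochner_Integration.integrable_bound)
        have "r t \<le> max t 0 / m 1 + 1 / m 1" for t
        proof (cases "t \<le> 1")
          case True
          have "r t \<le> r 1" by (rule monoD[OF that True])
          also have "\<dots> = 1 / m 1" by (simp add: r_def)
          also have "\<dots> \<le> max t 0 / m 1 + 1 / m 1" using m_pos[of 1] by simp
          finally show ?thesis .
        next
          case False
          then have "t / m t \<le> t / m 1"
            using truncated_neg_mean_mono[OF \<xi>, of 1 t] m_pos[of 1] m_pos[of t]
            by (intro divide_left_mono mult_pos_pos) (auto simp: m_def)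
          then show ?thesis using False m_pos[of 1] by (simp add: r_def add_increasing2)
        qed
        moreover have "0 \<le> max t 0 / m 1 + 1 / m 1" for t using m_pos[of 1] by simp
        ultimately show "AE t in ?\<mu>. norm (r t) \<le> norm (max t 0 / m 1 + 1 / m 1)"
          using r_nonneg by (intro AE_I2) auto
      qed simp
    next
      assume "F \<in> long_tailed \<inter> dominated_varying \<and> K_const F m < \<infinity>"
      then have "(\<integral>\<^sup>+t. ennreal (r t) \<partial>?\<mu>) < \<infinity>"
        using r_shift[of 0] by (simp add: K_const_def im)
      then show "integrable ?\<mu> r" by (intro integrableI_nonneg) (auto simp: r_nonneg)
    qed
  qed
  have "weighted_tail ?\<mu> r"
    unfolding r_def
  proof (rule weighted_tail_quotient)
    show "continuous_on {0<..} m" "filterlim m at_top at_top"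
      unfolding m_def
      by (rule truncated_neg_mean_continuous[OF \<xi>], rule truncated_neg_mean_at_top[OF \<xi> inf])
    show "m s \<le> m t" "s * m t \<le> t * m s" if "0 < s" "s \<le> t" for s t
      using truncated_neg_mean_mono[OF \<xi>, of s t] truncated_neg_mean_ratio[OF \<xi>, of s t] that
      by (auto simp: m_def)
  qed (use m_pos pos int \<mu>.real_distribution_axioms in \<open>simp_all add: F_def r_def\<close>)
  then interpret weighted_tail ?\<mu> r .
  have excess_nn: "(\<integral>\<^sup>+t\<in>{x<..}. ennreal ((t - x) / m (t - x)) \<partial>interval_measure F) = ennreal (excess x)" for x
    unfolding im r_shift excess_def
    by (intro nn_integral_eq_integral integrable_r_shift) (simp add: r_nonneg)
  have "G1 F m = excess_cdf"
  proof
    fix x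
    have "K_const F m = ennreal K" using excess_nn[of 0] by (simp add: K_const_def K_def)
    then show "G1 F m x = excess_cdf x"
      using K_pos excess_nonneg[of x] by (simp add: G1_def excess_nn excess_cdf_def divide_ennreal)
  qed
  then show ?thesis using excess_cdf_in_S_class cases by (auto simp: F_def)
qed

end
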